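(* For any integer $n\geq 2$, the independence number of $\mathcal{G}(\mathbb{Z}_n[x])$ is infinite; in fact, it is equal to $\aleph_0$.
   Context: $\mathbb{Z}_n$ denotes the ring of integers modulo $n$. For a commutative ring $R$ with identity, the involutory Cayley graph $\mathcal{G}(R)$ is the simple undirected graph with vertex set $R$ in which two vertices $a,b$ are adjacent if and only if $(a-b)^2=1$. An independent set in a graph is a set of vertices no two of which are adjacent; the independence number is the cardinality of a maximum independent set (an independent set of largest cardinality). *)

theory Defs
  imports
    "HOL-Algebra.UnivPoly"
    "HOL-Number_Theory.Residues"
    "Graph_Theory.Pair_Digraph"
begin

unbundle cardinal_syntax

text \<open>
  An undirected graph is represented as a symmetric loop-free digraph (locale
  \<open>pair_bidirected_digraph\<close>), without any finiteness restriction. The condition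
  \<open>a \<noteq> b\<close> only matters for the zero ring, where \<open>(a - a)\<^sup>2 = 1\<close>.
\<close>

definition involutory_cayley_graph :: "('a, 'm) ring_scheme \<Rightarrow> 'a pair_pre_digraph" where
  "involutory_cayley_graph R =
     \<lparr> pverts = carrier R,
       parcs = {(a, b). a \<in> carrier R \<and> b \<in> carrier R \<and> a \<noteq> b \<and>
                        (a \<ominus>\<^bsub>R\<^esub> b) [^]\<^bsub>R\<^esub> (2::nat) = \<one>\<^bsub>R\<^esub>} \<rparr>"

lemma pair_bidirected_digraph_involutory_cayley_graph:
  assumes "cring R"
  shows "pair_bidirected_digraph (involutory_cayley_graph R)"
proof -
  interpret cring R by fact
  have "(b \<ominus>\<^bsub>R\<^esub> a) [^]\<^bsub>R\<^esub> (2::nat) = (a \<ominus>\<^bsub>R\<^esub> b) [^]\<^bsub>R\<^esub> (2::nat)"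
    if "a \<in> carrier R" "b \<in> carrier R" for a b
  proof -
    have "b \<ominus>\<^bsub>R\<^esub> a = \<ominus>\<^bsub>R\<^esub> (a \<ominus>\<^bsub>R\<^esub> b)"
      using that by (simp add: minus_eq minus_add a_comm)
    moreover have "a \<ominus>\<^bsub>R\<^esub> b \<in> carrier R"
      using that by simp
    ultimately show ?thesis
      by (simp add: numeral_2_eq_2 l_minus r_minus)
  qed
  then have "sym (parcs (involutory_cayley_graph R))"
    by (auto simp: involutory_cayley_graph_def sym_def)
  then show ?thesis
    by unfold_locales
      (auto simp: involutory_cayley_graph_def symmetric_def)
qed

definition independent_set :: "'a pair_pre_digraph \<Rightarrow> 'a set \<Rightarrow> bool" where
  "independent_set G S \<longleftrightarrow>
     S \<subseteq> pverts G \<and> (\<forall>a\<in>S. \<forall>b\<in>S. (a, b) \<notin> parcs G)"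

definition maximum_independent_set :: "'a pair_pre_digraph \<Rightarrow> 'a set \<Rightarrow> bool" where
  "maximum_independent_set G S \<longleftrightarrow>
     independent_set G S \<and> (\<forall>T. independent_set G T \<longrightarrow> |T| \<le>o |S| )"

text \<open>
  A possibly infinite cardinal number, in the sense of the BNF cardinals: a minimal well-order,
  to be compared by \<open>=o\<close>. It is meaningful only if a maximum independent set exists.
\<close>

definition independence_number :: "'a pair_pre_digraph \<Rightarrow> 'a rel" where
  "independence_number G = |SOME S. maximum_independent_set G S|"

lemma independence_number_eq:
  assumes "maximum_independent_set G S"
  shows "independence_number G =o |S|"
proof -
  have "maximum_independent_set G (SOME S. maximum_independent_set G S)"
    using assms by (rule someI)
  with assms show ?thesis
    unfolding independence_number_def maximum_independent_set_def
    by (auto simp: ordIso_iff_ordLeq)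
qed

end

theory Submission
  imports Defs "HOL-Library.Countable_Set_Type"
begin

text \<open>
  Two elements of a proper ideal of a ring are never adjacent in its involutory Cayley graph:
  the square of their difference lies in the ideal, and \<open>\<one>\<close> does not. In a polynomial ring
  over a nontrivial ring, the ideal generated by the variable \<open>x\<close> is proper and contains the
  infinitely many powers \<open>x, x\<^sup>2, x\<^sup>3, \<dots>\<close>, so these form an infinite independent set
  (\<open>independent_set_powers_of_variable\<close>). Over a countable ring there are only countably many
  polynomials (\<open>countable_carrier_UP\<close>), so no set of vertices has a larger cardinality, and the
  independence number is \<open>\<aleph>\<^sub>0\<close>.
\<close>

lemma independence_number_countable_graph:
  assumes "countable (pverts G)" and "independent_set G S" and "infinite S"
  shows "maximum_independent_set G S" and "independence_number G =o natLeq"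
proof -
  have bound: "|T| \<le>o natLeq" if "independent_set G T" for T
    using countable_subset[OF _ assms(1)] that
    by (simp add: independent_set_def countable_card_le_natLeq)
  have natLeq_le: "natLeq \<le>o |S|"
    using assms(3) infinite_iff_natLeq_ordLeq by blast
  show max: "maximum_independent_set G S"
    unfolding maximum_independent_set_def
    using assms(2) bound natLeq_le ordLeq_transitive by blast
  have "|S| =o natLeq"
    using bound[OF assms(2)] natLeq_le by (simp add: ordIso_iff_ordLeq)
  with independence_number_eq[OF max] show "independence_number G =o natLeq"
    by (rule ordIso_transitive)
qed

text \<open>
  The bound on the degree makes a polynomial the zero-padding of a finite list of coefficients,
  and there are only countably many such lists.
\<close>

lemma countable_carrier_UP:
  assumes "countable (carrier R)"
  shows "countable (carrier (UP R))"
proof -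
  let ?pad = "\<lambda>cs i. if i < length cs then cs ! i else \<zero>\<^bsub>R\<^esub>"
  have "p \<in> ?pad ` lists (carrier R)" if p: "p \<in> carrier (UP R)" for p
  proof -
    obtain k where k: "\<And>i. k < i \<Longrightarrow> p i = \<zero>\<^bsub>R\<^esub>" and closed: "\<And>i. p i \<in> carrier R"
      using p by (auto simp: UP_def up_def bound_def)
    show ?thesis
    proof
      show "p = ?pad (map p [0..<Suc k])"
        using k by (auto simp: fun_eq_iff simp del: upt_Suc)
      show "map p [0..<Suc k] \<in> lists (carrier R)"
        using closed by auto
    qed
  qed
  then show ?thesis
    using countable_subset[OF subsetI countable_image[OF countable_lists[OF assms]]] by blast
qed

context UP_cring
begin

text \<open>
  Polynomials with constant coefficient \<open>\<zero>\<close> are the multiples of the variable, and taking the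
  constant coefficient is a ring homomorphism. So the square of a difference of two of them has
  constant coefficient \<open>\<zero>\<close>, whereas that of \<open>\<one>\<close> is \<open>\<one>\<close>.
\<close>

lemma independent_set_zero_constant_coeff:
  assumes "\<one>\<^bsub>R\<^esub> \<noteq> \<zero>\<^bsub>R\<^esub>" and "S \<subseteq> {p \<in> carrier P. coeff P p 0 = \<zero>\<^bsub>R\<^esub>}"
  shows "independent_set (involutory_cayley_graph P) S"
proof -
  have "(p \<ominus>\<^bsub>P\<^esub> q) [^]\<^bsub>P\<^esub> (2::nat) \<noteq> \<one>\<^bsub>P\<^esub>" if "p \<in> S" "q \<in> S" for p q
  proof
    have pq: "p \<in> carrier P" "q \<in> carrier P" "coeff P p 0 = \<zero>\<^bsub>R\<^esub>" "coeff P q 0 = \<zero>\<^bsub>R\<^esub>"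
      using assms(2) that by auto
    let ?d = "p \<ominus>\<^bsub>P\<^esub> q"
    have d: "?d \<in> carrier P" "coeff P ?d 0 = \<zero>\<^bsub>R\<^esub>"
      using pq by (simp_all add: R.minus_eq)
    then have "coeff P (?d \<otimes>\<^bsub>P\<^esub> ?d) 0 = \<zero>\<^bsub>R\<^esub>"
      by simp
    moreover assume "?d [^]\<^bsub>P\<^esub> (2::nat) = \<one>\<^bsub>P\<^esub>"
    then have "?d \<otimes>\<^bsub>P\<^esub> ?d = \<one>\<^bsub>P\<^esub>"
      using d(1) by (simp add: numeral_2_eq_2)
    ultimately show False
      using assms(1) by simp
  qed
  then show ?thesis
    using assms(2) unfolding independent_set_def involutory_cayley_graph_def by auto
qed

lemma independent_set_powers_of_variable:
  assumes "\<one>\<^bsub>R\<^esub> \<noteq> \<zero>\<^bsub>R\<^esub>"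
  shows "independent_set (involutory_cayley_graph P) (range (\<lambda>k. monom P \<one>\<^bsub>R\<^esub> (Suc k)))"
  using assms by (intro independent_set_zero_constant_coeff) auto

lemma infinite_powers_of_variable:
  assumes "\<one>\<^bsub>R\<^esub> \<noteq> \<zero>\<^bsub>R\<^esub>"
  shows "infinite (range (\<lambda>k. monom P \<one>\<^bsub>R\<^esub> (Suc k)))"
proof (rule range_inj_infinite, rule injI)
  fix i j
  assume "monom P \<one>\<^bsub>R\<^esub> (Suc i) = monom P \<one>\<^bsub>R\<^esub> (Suc j)"
  then have "deg R (monom P \<one>\<^bsub>R\<^esub> (Suc i)) = deg R (monom P \<one>\<^bsub>R\<^esub> (Suc j))"
    by simp
  with assms show "i = j"
    by simp
qed

end

theorem theorem3p5:
  fixes n :: int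
  assumes "n \<ge> 2"
  shows "(\<exists>S. maximum_independent_set (involutory_cayley_graph (UP (residue_ring n))) S) \<and>
         cinfinite (independence_number (involutory_cayley_graph (UP (residue_ring n)))) \<and>
         independence_number (involutory_cayley_graph (UP (residue_ring n))) =o natLeq"
proof -
  interpret residues n "residue_ring n"
    using assms by unfold_locales simp_all
  interpret UP_cring "residue_ring n" "UP (residue_ring n)"
    by unfold_locales simp
  let ?G = "involutory_cayley_graph (UP (residue_ring n))"
  have nontrivial: "\<one>\<^bsub>residue_ring n\<^esub> \<noteq> \<zero>\<^bsub>residue_ring n\<^esub>"
    using assms by (simp add: res_one_eq res_zero_eq)
  have "countable (pverts ?G)"
    by (simp add: involutory_cayley_graph_def countable_carrier_UP)
  note number = independence_number_countable_graph[OF this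
      independent_set_powers_of_variable[OF nontrivial] infinite_powers_of_variable[OF nontrivial]]
  have "cinfinite (independence_number ?G)"
    using number(2) natLeq_cinfinite cinfinite_mono ordIso_iff_ordLeq by blast
  with number show ?thesis
    by blast
qed

end
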